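(* If a conjugate partial-symmetric tensor $\mathcal{F}\in\mathbb{C}^{n^{2d}}$ is written as $\mathcal{F}=\sum_{k=1}^m\alpha_k\, \overline{\mathcal{H}_k}\otimes \mathcal{H}_k$, where $\mathcal{H}_k\in\mathbb{C}^{n^d}$ is symmetric and $\alpha_k\in\mathbb{R}$ for all $1\le k\le m$, and satisfies $\alpha_k\ge0$ for all $1\le k\le m$, then $$\max_{\boldsymbol{x}\in\mathbb{C}^n,\ \boldsymbol{x}^{\mathrm{H}}\boldsymbol{x}=1} \mathcal{F}(\underbrace{\overline{\boldsymbol{x}},\dots,\overline{\boldsymbol{x}}}_d, \underbrace{\boldsymbol{x},\dots,\boldsymbol{x}}_d) = \max_{\boldsymbol{x}^k\in\mathbb{C}^n,\ (\boldsymbol{x}^k)^{\mathrm{H}}\boldsymbol{x}^k=1,\ k=1,\dots,2d} \mathrm{Re}\,\mathcal{F}(\boldsymbol{x}^1,\dots,\boldsymbol{x}^{2d}).$$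
   Context: $\boldsymbol{x}^{\mathrm{H}}$ is the conjugate transpose of $\boldsymbol{x}$. For a tensor $\mathcal{F}\in\mathbb{C}^{n^{2d}}$, $\mathcal{F}(\boldsymbol{x}^1,\dots,\boldsymbol{x}^{2d})=\sum_{i_1,\dots,i_{2d}=1}^{n}\mathcal{F}_{i_1\dots i_{2d}}x^1_{i_1}\cdots x^{2d}_{i_{2d}}$ is its multilinear form. A tensor in $\mathbb{C}^{n^d}$ is symmetric if its entries are invariant under all permutations of the indices (no conjugation). $\overline{\mathcal{H}}$ is the entrywise conjugate, and $(\overline{\mathcal{H}}\otimes\mathcal{H})_{i_1\dots i_{2d}}=\overline{\mathcal{H}_{i_1\dots i_d}}\,\mathcal{H}_{i_{d+1}\dots i_{2d}}$. With $\Pi(i_1\dots i_d)$ the set of all distinct permutations of $i_1,\dots,i_d$, a tensor $\mathcal{F}\in\mathbb{C}^{n^{2d}}$ is conjugate partial-symmetric if for all $1\le i_1\le\dots\le i_d\le n$ and $1\le i_{d+1}\le\dots\le i_{2d}\le n$: (i) $\mathcal{F}_{i_1\dots i_d i_{d+1}\dots i_{2d}} = \mathcal{F}_{j_1\dots j_d j_{d+1}\dots j_{2d}}$ for all $(j_1\dots j_d) \in \Pi (i_1\dots i_d)$ and $(j_{d+1}\dots j_{2d})\in\Pi(i_{d+1}\dots i_{2d})$; and (ii) $\mathcal{F}_{i_1\dots i_d i_{d+1}\dots i_{2d}} = \overline{\mathcal{F}_{i_{d+1}\dots i_{2d} i_1\dots i_d}}$. For such $\mathcal{F}$ the value $\mathcal{F}(\overline{\boldsymbol{x}},\dots,\overline{\boldsymbol{x}},\boldsymbol{x},\dots,\boldsymbol{x})$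 ($d$ conjugated arguments followed by $d$ unconjugated ones) is real. *)

theory Defs
  imports "HOL-Analysis.Analysis" "HOL-Library.Multiset"
begin

text \<open>
  A complex tensor of order \<open>N\<close> over an \<open>n\<close>-element index set is a function on index lists,
  of which only the values on lists of length \<open>N\<close> are meaningful: \<open>T [i\<^sub>1, \<dots>, i\<^sub>N]\<close> is the
  entry at \<open>i\<^sub>1 \<dots> i\<^sub>N\<close>. The order is always an explicit parameter and the index set
  \<open>{1, \<dots>, n}\<close> is a finite linearly ordered type \<open>'n\<close>. Entries at lists of any other length
  are unconstrained and never used.
\<close>

type_synonym 'n tensor = "'n list \<Rightarrow> complex"

definition symmetric_tensor :: "nat \<Rightarrow> 'n tensor \<Rightarrow> bool" where
  "symmetric_tensor d H \<longleftrightarrow>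
     (\<forall>is js. length is = d \<longrightarrow> mset js = mset is \<longrightarrow> H js = H is)"

definition conjugate_partial_symmetric :: "nat \<Rightarrow> ('n::linorder) tensor \<Rightarrow> bool" where
  "conjugate_partial_symmetric d F \<longleftrightarrow>
     (\<forall>is js. length is = d \<longrightarrow> length js = d \<longrightarrow> sorted is \<longrightarrow> sorted js \<longrightarrow>
        (\<forall>is' js'. mset is' = mset is \<longrightarrow> mset js' = mset js \<longrightarrow> F (is @ js) = F (is' @ js')) \<and>
        F (is @ js) = cnj (F (js @ is)))"

definition conj_tensor :: "'n tensor \<Rightarrow> 'n tensor" where
  "conj_tensor H = (\<lambda>is. cnj (H is))"

text \<open>The argument \<open>d\<close> is the order of the left factor \<open>A\<close>.\<close>

definition outer_product :: "nat \<Rightarrow> 'n tensor \<Rightarrow> 'n tensor \<Rightarrow> 'n tensor" where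
  "outer_product d A B = (\<lambda>is. A (take d is) * B (drop d is))"

text \<open>\<open>multilinear_form T [x\<^sup>1, \<dots>, x\<^sup>N]\<close> treats \<open>T\<close> as a tensor of order \<open>N\<close>.\<close>

definition multilinear_form :: "('n::finite) tensor \<Rightarrow> (complex ^ 'n) list \<Rightarrow> complex" where
  "multilinear_form T xs =
     (\<Sum>is | length is = length xs. T is * (\<Prod>k<length xs. (xs ! k) $ (is ! k)))"

definition conj_vec :: "complex ^ 'n \<Rightarrow> complex ^ ('n::finite)" where
  "conj_vec x = (\<chi> i. cnj (x $ i))"

text \<open>\<open>herm_prod x y\<close> is \<open>x\<^sup>H y\<close>.\<close>

definition herm_prod :: "complex ^ 'n \<Rightarrow> complex ^ ('n::finite) \<Rightarrow> complex" where
  "herm_prod x y = (\<Sum>i\<in>UNIV. cnj (x $ i) * y $ i)"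

text \<open>The maximum of a possibly infinite set; its existence is part of the assertion.\<close>

definition is_maximum :: "real set \<Rightarrow> real \<Rightarrow> bool" where
  "is_maximum S M \<longleftrightarrow> M \<in> S \<and> (\<forall>s\<in>S. s \<le> M)"

lemma herm_prod_self_eq_1_iff: "herm_prod x x = 1 \<longleftrightarrow> norm x = 1"
proof -
  have "herm_prod x x = complex_of_real (\<Sum>i\<in>UNIV. (norm (x $ i))\<^sup>2)"
    unfolding herm_prod_def of_real_sum complex_norm_square by (simp add: mult.commute)
  also have "(\<Sum>i\<in>UNIV. (norm (x $ i))\<^sup>2) = (norm x)\<^sup>2"
    by (simp add: norm_vec_def L2_set_def sum_nonneg)
  finally show ?thesis
    by (simp add: power2_eq_1_iff flip: of_real_power) (smt (verit) norm_ge_zero)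
qed

lemma conjugate_partial_symmetric_cnj:
  assumes "conjugate_partial_symmetric d F" "length is = d" "length js = d"
  shows "F (is @ js) = cnj (F (js @ is))"
proof -
  have *: "F (as @ bs) = F (sort as @ sort bs)" if "length as = d" "length bs = d" for as bs
    using assms(1) that unfolding conjugate_partial_symmetric_def
    by (metis length_sort mset_sort sorted_sort)
  have "F (sort is @ sort js) = cnj (F (sort js @ sort is))"
    using assms unfolding conjugate_partial_symmetric_def
    by (metis length_sort sorted_sort)
  with *[of "is" js] *[of js "is"] assms show ?thesis by simp
qed

text \<open>The values maximised over the unit sphere are real, so taking real parts of them
  discards nothing.\<close>

lemma conjugate_partial_symmetric_form_real:
  assumes "conjugate_partial_symmetric d F"
  shows "Im (multilinear_form F (replicate d (conj_vec x) @ replicate d x)) = 0"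
proof -
  define p where "p = (\<lambda>is. \<Prod>k<d. x $ (is ! k))"
  define S where "S = {is :: 'a list. length is = 2 * d}"
  define r where "r = (\<lambda>is :: 'a list. drop d is @ take d is)"
  let ?v = "replicate d (conj_vec x) @ replicate d x"
  have pr: "(\<Prod>k<length ?v. (?v ! k) $ (is ! k)) = cnj (p (take d is)) * p (drop d is)"
    if "is \<in> S" for "is"
  proof -
    have "(\<Prod>k<length ?v. (?v ! k) $ (is ! k)) = (\<Prod>k<d + d. (?v ! k) $ (is ! k))" by simp
    also have "\<dots> = (\<Prod>k<d. (?v ! k) $ (is ! k)) * (\<Prod>k=d..<d + d. (?v ! k) $ (is ! k))"
      by (simp add: lessThan_atLeast0 prod.atLeastLessThan_concat)
    also have "(\<Prod>k=d..<d + d. (?v ! k) $ (is ! k)) = (\<Prod>k<d. (?v ! (k + d)) $ (is ! (k + d)))"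
      using prod.shift_bounds_nat_ivl[of "\<lambda>k. (?v ! k) $ (is ! k)" 0 d d]
      by (simp add: lessThan_atLeast0)
    also have "\<dots> = p (drop d is)"
      using that by (simp add: p_def S_def nth_append add.commute)
    also have "(\<Prod>k<d. (?v ! k) $ (is ! k)) = cnj (p (take d is))"
      by (simp add: p_def nth_append conj_vec_def)
    finally show ?thesis .
  qed
  have Fr: "cnj (F is) = F (r is)" if "is \<in> S" for "is"
    using conjugate_partial_symmetric_cnj[OF assms, of "drop d is" "take d is"] that
    by (simp add: S_def r_def)
  have form: "multilinear_form F ?v = (\<Sum>is\<in>S. F is * (cnj (p (take d is)) * p (drop d is)))"
    unfolding multilinear_form_def
  proof (rule sum.cong)
    show "{is. length is = length ?v} = S" by (simp add: S_def mult_2)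
  qed (simp only: pr)
  have "cnj (multilinear_form F ?v) = (\<Sum>is\<in>S. F (r is) * (cnj (p (drop d is)) * p (take d is)))"
    by (simp add: form Fr mult.commute)
  also have "\<dots> = (\<Sum>is\<in>S. F is * (cnj (p (take d is)) * p (drop d is)))"
    by (rule sum.reindex_bij_witness[where i = r and j = r]) (auto simp: S_def r_def)
  finally have "cnj (multilinear_form F ?v) = multilinear_form F ?v" by (simp add: form)
  then show ?thesis by (metis complex_cnj_cancel_iff cnj.simps(2) equal_neg_zero)
qed

end

theory Submission
  imports Defs
begin

text \<open>
  Write \<open>\<Phi>(a, b) = \<Sum>\<^sub>k \<alpha>\<^sub>k cnj(a\<^sub>k) b\<^sub>k\<close>, a Hermitian form that is positive semidefinite because the
  \<open>\<alpha>\<^sub>k\<close> are nonnegative. The decomposition of \<open>F\<close> says that \<open>F(xs, ys) = \<Phi>(a, b)\<close>, where \<open>a\<^sub>k\<close>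
  is \<open>H\<^sub>k\<close> at the conjugates of the \<open>d\<close> vectors \<open>xs\<close> and \<open>b\<^sub>k\<close> is \<open>H\<^sub>k\<close> at the \<open>d\<close> vectors \<open>ys\<close>.
  For fixed \<open>a\<close>, the map \<open>ys \<mapsto> \<Phi>(a, b)\<close> is the multilinear form of a symmetric tensor, namely of
  the linear combination \<open>\<Sum>\<^sub>k \<alpha>\<^sub>k cnj(a\<^sub>k) H\<^sub>k\<close>. By a theorem of Banach, a symmetric multilinear
  form on a finite-dimensional Hilbert space attains its largest modulus over unit vectors at a
  point where all its arguments coincide. So all of \<open>ys\<close> may be replaced by one unit vector \<open>v\<close> without decreasing the modulus,
  and then, by Hermitian symmetry, the conjugates of \<open>xs\<close> by one unit vector \<open>u\<close>. With \<open>D x\<close> for the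
  family of the values \<open>H\<^sub>k(x, \<dots>, x)\<close>, positivity gives
  \<open>|\<Phi>(D v, D u)| \<le> (\<Phi>(D v, D v) + \<Phi>(D u, D u)) / 2\<close>, and both terms on the right are values of
  \<open>F\<close> at arguments of the form \<open>(cnj x, \<dots>, cnj x, x, \<dots>, x)\<close>. Hence no value of \<open>Re F\<close> on unit
  vectors exceeds the maximum over such arguments, which exists by compactness of the sphere.

  Banach's theorem is \<open>symmetric_multilinear_norm_attained_on_diagonal\<close>, proved over the reals by
  averaging two arguments of a maximiser, which is possible by \<open>symmetric_bilinear_extremal\<close>;
  \<open>symmetric_tensor_norm_attained_on_diagonal\<close> is its form for tensors.
\<close>

section \<open>Symmetric multilinear maps attain their norm on the diagonal\<close>

text \<open>
  Polarisation writes \<open>4 B(x, y)\<close> as \<open>B(x + y, x + y) - B(x - y, x - y)\<close>, whose norm is at most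
  \<open>M (\<parallel>x + y\<parallel>\<^sup>2 + \<parallel>x - y\<parallel>\<^sup>2) = 4 M\<close> by the parallelogram law. If \<open>(x, y)\<close> attains the bound, then
  there is equality throughout, so the normalised sum of \<open>x\<close> and \<open>y\<close>, taken twice, attains it too.
\<close>

lemma symmetric_bilinear_extremal:
  fixes B :: "'a::real_inner \<Rightarrow> 'a \<Rightarrow> 'b::real_normed_vector"
  assumes "bilinear B" and sym: "\<And>a b. B a b = B b a"
    and le: "\<And>a b. norm (B a b) \<le> M * norm a * norm b"
    and xy: "norm x = 1" "norm y = 1" "norm (B x y) = M"
  shows "norm (B (x + y) (x + y)) = M * (norm (x + y))\<^sup>2"
proof -
  have "B (x + y) (x + y) - B (x - y) (x - y) = 4 *\<^sub>R B x y"
    using sym[of y x] scaleR_add_left[of 2 2 "B x y"] scaleR_add_left[of 1 1 "B x y"]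
    by (simp add: bilinear_ladd bilinear_radd bilinear_lsub bilinear_rsub assms(1))
  then have "4 * M \<le> norm (B (x + y) (x + y)) + norm (B (x - y) (x - y))"
    using norm_triangle_ineq4[of "B (x + y) (x + y)" "B (x - y) (x - y)"] xy by simp
  moreover have "norm (B (x - y) (x - y)) \<le> M * (norm (x - y))\<^sup>2"
    using le[of "x - y" "x - y"] by (simp add: power2_eq_square mult.assoc)
  moreover have "norm (B (x + y) (x + y)) \<le> M * (norm (x + y))\<^sup>2"
    using le[of "x + y" "x + y"] by (simp add: power2_eq_square mult.assoc)
  moreover have "(norm (x + y))\<^sup>2 + (norm (x - y))\<^sup>2 = 4"
    using xy by (simp add: power2_norm_eq_inner inner_simps norm_eq_1)
  then have "M * (norm (x + y))\<^sup>2 + M * (norm (x - y))\<^sup>2 = 4 * M"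
    by (metis distrib_left mult.commute)
  ultimately show ?thesis by linarith
qed

text \<open>Tychonoff's theorem in the product topology on functions.\<close>

lemma compact_unit_families:
  "compact {y :: 'i \<Rightarrow> 'a::euclidean_space. \<forall>i. norm (y i) = 1}"
proof -
  have "compactin (product_topology (\<lambda>_::'i. euclidean) UNIV) (PiE UNIV (\<lambda>_. sphere (0::'a) 1))"
    by (simp add: compactin_PiE)
  moreover have "PiE UNIV (\<lambda>_::'i. sphere (0::'a) 1) = {y. \<forall>i. norm (y i) = 1}"
    by auto
  ultimately show ?thesis by (simp add: euclidean_product_topology)
qed

text \<open>
  Banach's theorem. Arguments are families indexed by all naturals, of which only those below \<open>d\<close>
  matter, so that \<open>d\<close> can be a number and compactness is that of a product of spheres.

  Among the unit families that maximise \<open>\<parallel>f\<parallel>\<close>, take one for which the sum \<open>s\<close> of the first \<open>d\<close>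
  vectors is longest. Changing the sign of one vector gives another maximiser, so the choice of
  \<open>s\<close> forces each \<open>y\<^sub>i\<close> to have a positive inner product with \<open>s\<close>. If \<open>y\<^sub>i \<noteq> y\<^sub>j\<close>, replacing both
  by the unit vector along \<open>p = y\<^sub>i + y\<^sub>j\<close> keeps the maximum by \<open>symmetric_bilinear_extremal\<close> and
  adds to \<open>s\<close> a positive multiple of \<open>p\<close>, since \<open>\<parallel>p\<parallel> < 2\<close>; as \<open>s \<bullet> p > 0\<close>, this makes \<open>s\<close>
  longer, a contradiction. So the chosen family is constant.
\<close>

theorem symmetric_multilinear_norm_attained_on_diagonal:
  fixes f :: "(nat \<Rightarrow> 'a::euclidean_space) \<Rightarrow> 'b::real_normed_vector"
  assumes linear: "\<And>y i. i < d \<Longrightarrow> linear (\<lambda>v. f (y(i := v)))"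
    and sym: "\<And>y i j. i < d \<Longrightarrow> j < d \<Longrightarrow> f (y(i := y j, j := y i)) = f y"
    and local: "\<And>y z. (\<And>i. i < d \<Longrightarrow> y i = z i) \<Longrightarrow> f y = f z"
    and cont: "continuous_on UNIV f"
  shows "\<exists>u. norm u = 1 \<and> (\<forall>y. (\<forall>i<d. norm (y i) = 1) \<longrightarrow> norm (f y) \<le> norm (f (\<lambda>_. u)))"
proof -
  define S where "S = {y :: nat \<Rightarrow> 'a. \<forall>i. norm (y i) = 1}"
  obtain b :: 'a where b: "norm b = 1" using vector_choose_size[of 1] by auto
  have "compact S" unfolding S_def by (rule compact_unit_families)
  moreover have "(\<lambda>_. b) \<in> S" by (simp add: S_def b)
  moreover have "continuous_on S (\<lambda>y. norm (f y))"
    by (intro continuous_on_norm continuous_on_subset[OF cont]) simp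
  ultimately obtain y0 where y0: "y0 \<in> S" "\<And>y. y \<in> S \<Longrightarrow> norm (f y) \<le> norm (f y0)"
    using continuous_attains_sup[of S "\<lambda>y. norm (f y)"] by auto
  define M where "M = norm (f y0)"
  define K where "K = S \<inter> {y. norm (f y) = M}"
  define s where "s = (\<lambda>y :: nat \<Rightarrow> 'a. \<Sum>i<d. y i)"
  have "closed {y. norm (f y) = M}"
    by (intro closed_Collect_eq continuous_intros cont)
  then have "compact K" unfolding K_def using \<open>compact S\<close> by (rule compact_Int_closed[rotated])
  moreover have "y0 \<in> K" using y0 by (simp add: K_def M_def)
  moreover have "continuous_on K (\<lambda>y. norm (s y))" unfolding s_def
    by (intro continuous_on_norm continuous_on_sum continuous_on_subset[OF continuous_on_product_coordinates]) simp
  ultimately obtain y where y: "y \<in> K" and ymax: "\<And>z. z \<in> K \<Longrightarrow> norm (s z) \<le> norm (s y)"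
    using continuous_attains_sup[of K "\<lambda>y. norm (s y)"] by auto
  have unit: "norm (y i) = 1" for i using y by (simp add: K_def S_def)
  have fy: "norm (f y) = M" using y by (simp add: K_def)
  have s_upd: "s (z(i := v)) = s z - z i + v" if "i < d" for z i v
  proof -
    have "s x = x i + sum x ({..<d} - {i})" for x
      unfolding s_def using that by (subst sum.remove[of _ i]) auto
    moreover have "sum (z(i := v)) ({..<d} - {i}) = sum z ({..<d} - {i})"
      by (rule sum.cong) auto
    ultimately show ?thesis by simp
  qed
  have pos: "s y \<bullet> y i \<ge> 1" if i: "i < d" for i
  proof -
    \<comment> \<open>Comparing \<open>\<parallel>s - 2 y\<^sub>i\<parallel>\<^sup>2 = \<parallel>s\<parallel>\<^sup>2 - 4 (s \<bullet> y\<^sub>i) + 4\<close> with \<open>\<parallel>s\<parallel>\<^sup>2\<close> gives the constant 1.\<close>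
    let ?z = "y(i := - y i)"
    have "f ?z = - f y"
      using linear_neg[OF linear[OF i, of y], of "y i"] by simp
    then have "?z \<in> K" using y by (simp add: K_def S_def)
    then have "(norm (s ?z))\<^sup>2 \<le> (norm (s y))\<^sup>2" using ymax by (simp add: power_mono)
    moreover have "s ?z = s y - 2 *\<^sub>R y i" by (simp add: s_upd[OF i] scaleR_2)
    moreover have "y i \<bullet> y i = 1" using unit by (simp add: norm_eq_1)
    ultimately show ?thesis by (simp add: power2_norm_eq_inner inner_simps inner_commute)
  qed
  have eq: "y i = y j" if i: "i < d" and j: "j < d" for i j
  proof (rule ccontr)
    assume ne: "y i \<noteq> y j"
    then have ij: "i \<noteq> j" by auto
    define B where "B = (\<lambda>a b. f (y(i := a, j := b)))"
    have "linear (\<lambda>a. B a b)" for b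
      using linear[OF i, of "y(j := b)"] ij by (simp add: B_def fun_upd_twist)
    then have "bilinear B"
      using linear[OF j] by (simp add: bilinear_def B_def)
    have "B a b = B b a" for a b
      using sym[OF i j, of "y(i := a, j := b)"] ij by (simp add: B_def fun_upd_twist)
    moreover have "norm (B a b) \<le> M * norm a * norm b" for a b
    proof (cases "a = 0 \<or> b = 0")
      case True
      then show ?thesis using bilinear_lzero[OF \<open>bilinear B\<close>] bilinear_rzero[OF \<open>bilinear B\<close>] by auto
    next
      case False
      then have "norm (B (sgn a) (sgn b)) \<le> M"
        unfolding B_def M_def using unit by (intro y0) (auto simp: S_def norm_sgn)
      moreover have "B a b = (norm a * norm b) *\<^sub>R B (sgn a) (sgn b)"
        using False by (simp add: sgn_div_norm bilinear_lmul[OF \<open>bilinear B\<close>] bilinear_rmul[OF \<open>bilinear B\<close>] field_simps)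
      ultimately show ?thesis
        using mult_left_mono[of "norm (B (sgn a) (sgn b))" M "norm a * norm b"]
        by (simp add: mult_ac)
    qed
    moreover have "norm (B (y i) (y j)) = M" using fy by (simp add: B_def)
    ultimately have ext: "norm (B (y i + y j) (y i + y j)) = M * (norm (y i + y j))\<^sup>2"
      using symmetric_bilinear_extremal[OF \<open>bilinear B\<close>, of M "y i" "y j"] unit by blast
    define p where "p = y i + y j"
    have sp: "s y \<bullet> p \<ge> 2" using pos[OF i] pos[OF j] by (simp add: p_def inner_simps)
    then have "p \<noteq> 0" by auto
    have "norm p < 2"
    proof (rule ccontr)
      assume "\<not> norm p < 2"
      then have "4 \<le> (norm p)\<^sup>2" using power_mono[of 2 "norm p" 2] by simp
      moreover have "(norm p)\<^sup>2 + (norm (y i - y j))\<^sup>2 = 4"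
        using unit by (simp add: p_def power2_norm_eq_inner inner_simps norm_eq_1)
      ultimately have "(norm (y i - y j))\<^sup>2 \<le> 0" by linarith
      then show False using ne by simp
    qed
    \<comment> \<open>The new pair sums to \<open>2 p / \<parallel>p\<parallel>\<close> instead of \<open>p\<close>, so the total sum moves by \<open>c p\<close>.\<close>
    define c where "c = 2 / norm p - 1"
    have "c > 0" using \<open>norm p < 2\<close> \<open>p \<noteq> 0\<close> by (simp add: c_def)
    let ?z = "y(i := sgn p, j := sgn p)"
    have "f ?z = inverse (norm p) *\<^sub>R inverse (norm p) *\<^sub>R B p p"
      unfolding sgn_div_norm
      using bilinear_lmul[OF \<open>bilinear B\<close>] bilinear_rmul[OF \<open>bilinear B\<close>] by (simp add: B_def)
    then have "norm (f ?z) = M"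
      using ext \<open>p \<noteq> 0\<close> by (simp add: p_def[symmetric] power2_eq_square field_simps)
    then have "?z \<in> K" using y \<open>p \<noteq> 0\<close> by (simp add: K_def S_def norm_sgn)
    then have "(norm (s ?z))\<^sup>2 \<le> (norm (s y))\<^sup>2" using ymax by (simp add: power_mono)
    moreover have "s ?z = s y + c *\<^sub>R p"
      using ij by (simp add: s_upd[OF i] s_upd[OF j] c_def sgn_div_norm p_def algebra_simps
          divide_inverse flip: scaleR_2)
    then have "(norm (s ?z))\<^sup>2 = (norm (s y))\<^sup>2 + 2 * c * (s y \<bullet> p) + c\<^sup>2 * (norm p)\<^sup>2"
      unfolding power2_norm_eq_inner
      by (simp add: inner_simps inner_commute power2_eq_square algebra_simps)
    ultimately have "2 * c * (s y \<bullet> p) + c\<^sup>2 * (norm p)\<^sup>2 \<le> 0" by linarith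
    moreover have "2 * c * (s y \<bullet> p) > 0" using \<open>c > 0\<close> sp by simp
    moreover have "c\<^sup>2 * (norm p)\<^sup>2 \<ge> 0" by simp
    ultimately show False by linarith
  qed
  \<comment> \<open>For \<open>d = 0\<close> this holds because \<open>f\<close> is constant.\<close>
  have diag: "f (\<lambda>_. y 0) = f y"
  proof (rule local)
    fix i assume "i < d"
    then show "y 0 = y i" using eq[of 0 i] by simp
  qed
  show ?thesis
  proof (intro exI conjI allI impI)
    show "norm (y 0) = 1" by (rule unit)
  next
    fix z :: "nat \<Rightarrow> 'a" assume z: "\<forall>i<d. norm (z i) = 1"
    \<comment> \<open>The maximum was taken over families all of whose members are unit vectors.\<close>
    have "f z = f (\<lambda>i. if i < d then z i else b)" by (rule local) simp
    also have "norm \<dots> \<le> M"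
      unfolding M_def using z b by (intro y0) (auto simp: S_def)
    finally show "norm (f z) \<le> norm (f (\<lambda>_. y 0))" by (simp add: diag fy)
  qed
qed

section \<open>Multilinear forms of tensors\<close>

lemma linear_multilinear_form_list_update:
  assumes "i < length xs"
  shows "linear (\<lambda>v. multilinear_form T (xs[i := v]))"
proof -
  have "(\<Prod>k<length xs. (xs[i := v] ! k) $ (is ! k))
      = v $ (is ! i) * (\<Prod>k\<in>{..<length xs} - {i}. (xs ! k) $ (is ! k))" for v "is"
    using assms by (subst prod.remove[of _ i]) auto
  then have "(\<lambda>v. multilinear_form T (xs[i := v])) = (\<lambda>v. \<Sum>is | length is = length xs.
      T is * (v $ (is ! i) * (\<Prod>k\<in>{..<length xs} - {i}. (xs ! k) $ (is ! k))))"
    by (simp add: multilinear_form_def)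
  then show ?thesis
    by (simp only:) (rule linearI; simp add: algebra_simps sum.distrib scaleR_sum_right)
qed

text \<open>
  Reindexing the sum by the same permutation of the index lists leaves the entries of \<open>T\<close> unchanged
  and turns the product into a reordering of the original one.
\<close>

lemma multilinear_form_permute_list:
  assumes T: "symmetric_tensor (length xs) T" and p: "p permutes {..<length xs}"
  shows "multilinear_form T (permute_list p xs) = multilinear_form T xs"
proof -
  let ?N = "length xs"
  let ?I = "{is :: 'a list. length is = ?N}"
  have inv: "inv p permutes {..<?N}" using p by (rule permutes_inv)
  have comp: "permute_list q (permute_list r js) = js"
    if "q permutes {..<?N}" "r \<circ> q = id" "length js = ?N" for q r and js :: "'a list"
    using permute_list_compose[of q js r] that by simp
  have "multilinear_form T (permute_list p xs)
      = (\<Sum>is\<in>?I. T is * (\<Prod>k<?N. (xs ! p k) $ (is ! k)))"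
    by (simp add: multilinear_form_def permute_list_nth[OF p])
  also have "\<dots> = (\<Sum>is\<in>?I. T (permute_list p is) * (\<Prod>k<?N. (xs ! p k) $ (permute_list p is ! k)))"
    using permutes_inv_o[OF p] comp[OF p] comp[OF inv]
    by (intro sum.reindex_bij_witness[where j = "permute_list (inv p)" and i = "permute_list p"])
      auto
  also have "\<dots> = (\<Sum>is\<in>?I. T is * (\<Prod>k<?N. (xs ! k) $ (is ! k)))"
  proof (rule sum.cong)
    fix js assume "js \<in> ?I"
    then have js: "length js = ?N" by simp
    then have "mset (permute_list p js) = mset js" using p by (simp add: mset_permute_list)
    then have "T (permute_list p js) = T js"
      using T js unfolding symmetric_tensor_def by blast
    moreover have "(\<Prod>k<?N. (xs ! p k) $ (permute_list p js ! k)) = (\<Prod>k<?N. (xs ! p k) $ (js ! p k))"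
      using js p by (intro prod.cong) (auto simp: permute_list_nth)
    moreover have "\<dots> = (\<Prod>k<?N. (xs ! k) $ (js ! k))"
      using prod.permute[OF p, of "\<lambda>k. (xs ! k) $ (js ! k)"] by (simp add: o_def)
    ultimately show "T (permute_list p js) * (\<Prod>k<?N. (xs ! p k) $ (permute_list p js ! k))
        = T js * (\<Prod>k<?N. (xs ! k) $ (js ! k))" by simp
  qed simp
  also have "\<dots> = multilinear_form T xs" by (simp add: multilinear_form_def)
  finally show ?thesis .
qed

text \<open>
  Banach's theorem with the complex space regarded as a real Euclidean one: a complex multilinear
  form is real multilinear, and the unit vectors are the same.
\<close>

theorem symmetric_tensor_norm_attained_on_diagonal:
  fixes T :: "'n::finite tensor"
  assumes T: "symmetric_tensor d T"
  obtains u where "norm u = 1"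
    and "\<And>xs. length xs = d \<Longrightarrow> \<forall>x\<in>set xs. norm x = 1 \<Longrightarrow>
          norm (multilinear_form T xs) \<le> norm (multilinear_form T (replicate d u))"
proof -
  define f where "f = (\<lambda>y. multilinear_form T (map y [0..<d]))"
  have lin: "linear (\<lambda>v. f (y(i := v)))" if "i < d" for y i
  proof -
    have "map (y(i := v)) [0..<d] = (map y [0..<d])[i := v]" for v
      by (rule nth_equalityI) (auto simp: nth_list_update)
    then show ?thesis
      using that linear_multilinear_form_list_update[of i "map y [0..<d]" T] by (simp add: f_def)
  qed
  have sym: "f (y(i := y j, j := y i)) = f y" if "i < d" "j < d" for y i j
  proof -
    let ?p = "Transposition.transpose i j"
    have p: "?p permutes {..<d}" using that by (intro permutes_swap_id) auto
    have "map (y(i := y j, j := y i)) [0..<d] = permute_list ?p (map y [0..<d])"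
      using that by (intro nth_equalityI)
        (auto simp: permute_list_def transpose_def)
    then show ?thesis
      using multilinear_form_permute_list[of "map y [0..<d]" T ?p] T p by (simp add: f_def)
  qed
  have loc: "f y = f z" if "\<And>i. i < d \<Longrightarrow> y i = z i" for y z
  proof -
    have "map y [0..<d] = map z [0..<d]" using that by simp
    then show ?thesis unfolding f_def by (rule arg_cong)
  qed
  have "continuous_on UNIV f"
    unfolding f_def multilinear_form_def by (simp, intro continuous_intros) auto
  then obtain u where u: "norm u = 1"
    "\<And>y. \<forall>i<d. norm (y i) = 1 \<Longrightarrow> norm (f y) \<le> norm (f (\<lambda>_. u))"
    using symmetric_multilinear_norm_attained_on_diagonal[of d f, OF lin sym loc] by blast
  show thesis
  proof (rule that[OF u(1)])
    fix xs :: "(complex^'n) list" assume xs: "length xs = d" "\<forall>x\<in>set xs. norm x = 1"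
    then have "map ((!) xs) [0..<d] = xs" by (metis map_nth)
    moreover have "map (\<lambda>_. u) [0..<d] = replicate d u" by (simp add: map_replicate_const)
    ultimately show "norm (multilinear_form T xs) \<le> norm (multilinear_form T (replicate d u))"
      using u(2)[of "(!) xs"] xs by (simp add: f_def)
  qed
qed

lemma multilinear_form_sum:
  "multilinear_form (\<lambda>is. \<Sum>k\<in>A. c k * T k is) xs = (\<Sum>k\<in>A. c k * multilinear_form (T k) xs)"
  unfolding multilinear_form_def
  by (simp add: sum_distrib_left sum_distrib_right mult.assoc sum.swap[of _ A])

lemma multilinear_form_conj_tensor:
  "multilinear_form (conj_tensor T) xs = cnj (multilinear_form T (map conj_vec xs))"
  by (simp add: multilinear_form_def conj_tensor_def conj_vec_def)

lemma prod_lessThan_add: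
  fixes g :: "nat \<Rightarrow> 'a::comm_monoid_mult"
  shows "(\<Prod>k<m + n. g k) = (\<Prod>k<m. g k) * (\<Prod>k<n. g (m + k))"
  by (induction n) (simp_all add: mult.assoc)

lemma multilinear_form_outer_product:
  assumes d: "length xs = d"
  shows "multilinear_form (outer_product d A B) (xs @ ys)
    = multilinear_form A xs * multilinear_form B ys"
proof -
  let ?e = "length ys"
  let ?P = "\<lambda>xs is. \<Prod>k<length xs. (xs ! k) $ (is ! k)"
  have split: "?P (xs @ ys) (is @ js) = ?P xs is * ?P ys js" if "length is = d" for "is" js
  proof -
    have "?P (xs @ ys) (is @ js) = (\<Prod>k<d + ?e. ((xs @ ys) ! k) $ ((is @ js) ! k))"
      by (simp add: d)
    also have "\<dots> = (\<Prod>k<d. ((xs @ ys) ! k) $ ((is @ js) ! k))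
        * (\<Prod>k<?e. ((xs @ ys) ! (d + k)) $ ((is @ js) ! (d + k)))"
      by (rule prod_lessThan_add)
    also have "\<dots> = ?P xs is * ?P ys js" using that d by (simp add: nth_append)
    finally show ?thesis .
  qed
  have "multilinear_form A xs * multilinear_form B ys
      = (\<Sum>(is, js)\<in>{is. length is = d} \<times> {js. length js = ?e}.
          A is * ?P xs is * (B js * ?P ys js))"
    by (simp add: multilinear_form_def d sum_product sum.cartesian_product)
  also have "\<dots> = (\<Sum>is | length is = length (xs @ ys).
      outer_product d A B is * ?P (xs @ ys) is)"
  proof (rule sum.reindex_bij_witness[where i = "\<lambda>is. (take d is, drop d is)"
        and j = "\<lambda>(is, js). is @ js"])
    fix q :: "'a list \<times> 'a list"
    assume "q \<in> {is :: 'a list. length is = d} \<times> {js. length js = ?e}"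
    then obtain "is" js where q: "q = (is, js)" "length is = d" "length js = ?e" by auto
    show "outer_product d A B (case q of (is, js) \<Rightarrow> is @ js)
          * ?P (xs @ ys) (case q of (is, js) \<Rightarrow> is @ js)
        = (case q of (is, js) \<Rightarrow> A is * ?P xs is * (B js * ?P ys js))"
      using split[OF q(2), of js] by (simp only: q(1) case_prod_conv) (simp add: outer_product_def q)
  qed (auto simp: d)
  also have "\<dots> = multilinear_form (outer_product d A B) (xs @ ys)"
    by (simp add: multilinear_form_def)
  finally show ?thesis by simp
qed

text \<open>
  The arithmetic-geometric form of the Cauchy-Schwarz inequality for a diagonal positive
  semidefinite Hermitian form; this is where the sign of the weights enters.
\<close>

lemma norm_weighted_hermitian_sum_le:
  fixes a b :: "'i \<Rightarrow> complex" and \<alpha> :: "'i \<Rightarrow> real"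
  assumes "\<And>k. k \<in> A \<Longrightarrow> \<alpha> k \<ge> 0"
  shows "2 * norm (\<Sum>k\<in>A. \<alpha> k * (cnj (a k) * b k))
    \<le> Re (\<Sum>k\<in>A. \<alpha> k * (cnj (a k) * a k)) + Re (\<Sum>k\<in>A. \<alpha> k * (cnj (b k) * b k))"
proof -
  have sq: "Re (z * cnj z) = (norm z)\<^sup>2" for z :: complex
    by (simp flip: complex_norm_square)
  have "2 * norm (\<alpha> k * (cnj (a k) * b k))
      \<le> Re (\<alpha> k * (cnj (a k) * a k)) + Re (\<alpha> k * (cnj (b k) * b k))" if "k \<in> A" for k
  proof -
    have "Re (\<alpha> k * (cnj (a k) * a k)) + Re (\<alpha> k * (cnj (b k) * b k))
        = \<alpha> k * ((norm (a k))\<^sup>2 + (norm (b k))\<^sup>2)"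
      using sq[of "a k"] sq[of "b k"]
      by (simp only: Re_complex_of_real Im_complex_of_real times_complex.sel mult.commute[of "cnj _"])
        (simp add: distrib_left)
    moreover have "2 * norm (\<alpha> k * (cnj (a k) * b k)) = \<alpha> k * (2 * norm (a k) * norm (b k))"
      using assms[OF that] by (simp add: norm_mult)
    moreover have "2 * norm (a k) * norm (b k) \<le> (norm (a k))\<^sup>2 + (norm (b k))\<^sup>2"
      by (rule sum_squares_bound)
    ultimately show ?thesis using assms[OF that] by (metis mult_left_mono)
  qed
  then have "(\<Sum>k\<in>A. 2 * norm (\<alpha> k * (cnj (a k) * b k)))
      \<le> (\<Sum>k\<in>A. Re (\<alpha> k * (cnj (a k) * a k)) + Re (\<alpha> k * (cnj (b k) * b k)))"
    by (rule sum_mono)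
  moreover have "norm (\<Sum>k\<in>A. \<alpha> k * (cnj (a k) * b k)) \<le> (\<Sum>k\<in>A. norm (\<alpha> k * (cnj (a k) * b k)))"
    by (rule norm_sum)
  ultimately show ?thesis by (simp add: sum.distrib flip: sum_distrib_left)
qed

lemma conj_vec_conj_vec [simp]: "conj_vec (conj_vec x) = x"
  by (simp add: conj_vec_def vec_eq_iff)

lemma norm_conj_vec [simp]: "norm (conj_vec x) = norm x"
  by (simp add: norm_vec_def conj_vec_def)

section \<open>Equality of the two maxima\<close>

theorem theorem5p5:
  fixes d m :: nat
    and F :: "('n::{finite,linorder}) tensor"
    and H :: "nat \<Rightarrow> 'n tensor"
    and \<alpha> :: "nat \<Rightarrow> real"
  assumes "conjugate_partial_symmetric d F"
    and "\<And>k. k \<in> {1..m} \<Longrightarrow> symmetric_tensor d (H k)"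
    and "\<And>is. length is = 2 * d \<Longrightarrow>
           F is = (\<Sum>k=1..m. complex_of_real (\<alpha> k) * outer_product d (conj_tensor (H k)) (H k) is)"
    and "\<And>k. k \<in> {1..m} \<Longrightarrow> \<alpha> k \<ge> 0"
  shows "\<exists>M. is_maximum
               {Re (multilinear_form F (replicate d (conj_vec x) @ replicate d x)) |
                x. herm_prod x x = 1} M
           \<and> is_maximum
               {Re (multilinear_form F xs) |
                xs. length xs = 2 * d \<and> (\<forall>x\<in>set xs. herm_prod x x = 1)} M"
proof -
  define h where "h = (\<lambda>k. multilinear_form (H k))"
  define \<Phi> where "\<Phi> = (\<lambda>a b :: nat \<Rightarrow> complex. \<Sum>k=1..m. \<alpha> k * (cnj (a k) * b k))"
  define D where "D = (\<lambda>x k. h k (replicate d x))"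
  have cnj_\<Phi>: "cnj (\<Phi> a b) = \<Phi> b a" for a b by (simp add: \<Phi>_def mult.commute)
  have form: "multilinear_form F (xs @ ys) = \<Phi> (\<lambda>k. h k (map conj_vec xs)) (\<lambda>k. h k ys)"
    if "length xs = d" "length ys = d" for xs ys
  proof -
    have "multilinear_form F (xs @ ys) = multilinear_form
        (\<lambda>is. \<Sum>k=1..m. \<alpha> k * outer_product d (conj_tensor (H k)) (H k) is) (xs @ ys)"
      using that by (simp add: multilinear_form_def assms(3))
    then show ?thesis
      using that by (simp add: multilinear_form_sum multilinear_form_outer_product
          multilinear_form_conj_tensor \<Phi>_def h_def)
  qed
  have diag: "multilinear_form F (replicate d (conj_vec x) @ replicate d x) = \<Phi> (D x) (D x)" for x
    by (simp add: form D_def)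
  have banach: "\<exists>u. norm u = 1 \<and> (\<forall>ys. length ys = d \<longrightarrow> (\<forall>y\<in>set ys. norm y = 1) \<longrightarrow>
      norm (\<Phi> a (\<lambda>k. h k ys)) \<le> norm (\<Phi> a (D u)))" for a
  proof -
    \<comment> \<open>As a function of the vectors \<open>ys\<close>, this is the form of one symmetric tensor.\<close>
    define T where "T = (\<lambda>is. \<Sum>k=1..m. (\<alpha> k * cnj (a k)) * H k is)"
    have "symmetric_tensor d T"
      unfolding T_def symmetric_tensor_def
    proof (intro allI impI sum.cong refl)
      fix "is" js :: "'n list" and k
      assume "length is = d" "mset js = mset is" "k \<in> {1..m}"
      then have "H k js = H k is" using assms(2) unfolding symmetric_tensor_def by blast
      then show "\<alpha> k * cnj (a k) * H k js = \<alpha> k * cnj (a k) * H k is" by simp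
    qed
    moreover have "multilinear_form T ys = \<Phi> a (\<lambda>k. h k ys)" for ys
      unfolding T_def multilinear_form_sum by (simp add: \<Phi>_def h_def mult.assoc)
    ultimately show ?thesis
      unfolding D_def by (metis symmetric_tensor_norm_attained_on_diagonal)
  qed
  have "continuous_on (sphere 0 1) (\<lambda>x. Re (\<Phi> (D x) (D x)))"
    unfolding \<Phi>_def D_def h_def multilinear_form_def
    by (simp, intro continuous_intros)
  moreover obtain e :: "(complex, 'n) vec" where "norm e = 1" using vector_choose_size[of 1] by auto
  ultimately obtain w where w: "norm w = 1"
    and wmax: "\<And>x. norm x = 1 \<Longrightarrow> Re (\<Phi> (D x) (D x)) \<le> Re (\<Phi> (D w) (D w))"
    using continuous_attains_sup[of "sphere 0 1 :: (complex, 'n) vec set" "\<lambda>x. Re (\<Phi> (D x) (D x))"]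
    by (force simp: dist_norm)
  have bound: "Re (multilinear_form F xs) \<le> Re (\<Phi> (D w) (D w))"
    if xs: "length xs = 2 * d" "\<forall>x\<in>set xs. norm x = 1" for xs
  proof -
    define a where "a = (\<lambda>k. h k (map conj_vec (take d xs)))"
    obtain v where v: "norm v = 1"
      "\<And>ys. length ys = d \<Longrightarrow> \<forall>y\<in>set ys. norm y = 1 \<Longrightarrow>
        norm (\<Phi> a (\<lambda>k. h k ys)) \<le> norm (\<Phi> a (D v))"
      using banach[of a] by blast
    obtain u where u: "norm u = 1"
      "\<And>ys. length ys = d \<Longrightarrow> \<forall>y\<in>set ys. norm y = 1 \<Longrightarrow>
        norm (\<Phi> (D v) (\<lambda>k. h k ys)) \<le> norm (\<Phi> (D v) (D u))"
      using banach[of "D v"] by blast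
    have "Re (multilinear_form F xs) \<le> norm (multilinear_form F (take d xs @ drop d xs))"
      by (simp add: complex_Re_le_cmod)
    also have "\<dots> = norm (\<Phi> a (\<lambda>k. h k (drop d xs)))"
      using xs by (subst form) (simp_all add: a_def)
    also have "\<dots> \<le> norm (\<Phi> a (D v))"
      using xs by (intro v(2)) (auto dest: in_set_dropD)
    also have "\<dots> = norm (\<Phi> (D v) a)" by (metis cnj_\<Phi> complex_mod_cnj)
    also have "\<dots> \<le> norm (\<Phi> (D v) (D u))"
      unfolding a_def using xs by (intro u(2)) (auto dest: in_set_takeD)
    also have "\<dots> \<le> (Re (\<Phi> (D v) (D v)) + Re (\<Phi> (D u) (D u))) / 2"
      using norm_weighted_hermitian_sum_le[of "{1..m}" \<alpha> "D v" "D u"] assms(4)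
      by (simp add: \<Phi>_def)
    also have "\<dots> \<le> Re (\<Phi> (D w) (D w))" using wmax[OF u(1)] wmax[OF v(1)] by simp
    finally show ?thesis .
  qed
  show ?thesis
  proof (intro exI[of _ "Re (\<Phi> (D w) (D w))"] conjI)
    show "is_maximum {Re (multilinear_form F (replicate d (conj_vec x) @ replicate d x)) |
        x. herm_prod x x = 1} (Re (\<Phi> (D w) (D w)))"
      unfolding is_maximum_def diag herm_prod_self_eq_1_iff using w wmax by blast
  next
    let ?ws = "replicate d (conj_vec w) @ replicate d w"
    have "Re (\<Phi> (D w) (D w)) = Re (multilinear_form F ?ws)" by (simp add: diag)
    moreover have "length ?ws = 2 * d" "\<forall>x\<in>set ?ws. norm x = 1" using w by auto
    ultimately show "is_maximum {Re (multilinear_form F xs) |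
        xs. length xs = 2 * d \<and> (\<forall>x\<in>set xs. herm_prod x x = 1)} (Re (\<Phi> (D w) (D w)))"
      unfolding is_maximum_def herm_prod_self_eq_1_iff using bound by blast
  qed
qed

end
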